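(* Let $2\le d\le r$ and $n\ge 1$ be integers and let $\mathcal{H}$ be a $d$-uniform $r$-partite hypergraph that satisfies condition $(\ast\ast)$ for $r$, with $r$-partition $V_i=\{x_{1i},\ldots,x_{ni}\}$, $1\le i\le r$, such that $\{x_{j1},x_{j2},\ldots,x_{jr}\}$ is a clique for every $1\le j\le n$. Then $\mathcal{H}$ is unmixed if and only if the following condition holds: for every $1\le q\le n$, if $\mathfrak{e}_1,\mathfrak{e}_2,\ldots,\mathfrak{e}_{r-d+2}$ are (not necessarily distinct) submaximal edges such that $$\mathfrak{e}_1\sim x_{qi_1},\ \mathfrak{e}_2\sim x_{qi_2},\ \ldots,\ \mathfrak{e}_{r-d+2}\sim x_{qi_{r-d+2}},$$ where $i_1,i_2,\ldots,i_{r-d+2}\in\{1,\ldots,r\}$ are pairwise distinct, then the set $\mathfrak{e}_1\cup\mathfrak{e}_2\cup\cdots\cup\mathfrak{e}_{r-d+2}$ is not independent.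
   Context: A hypergraph $\mathcal{H}$ on a finite nonempty set $V=V(\mathcal{H})$ (the vertices) is a set $E(\mathcal{H})$ of nonempty subsets of $V$ (the hyperedges) whose union is $V$. It is $d$-uniform if every hyperedge has exactly $d$ elements. It is $r$-partite ($r\ge 2$) if $V(\mathcal{H})$ can be partitioned into $r$ subsets (parts) such that no two distinct vertices of the same part lie in a common hyperedge; such a partition is an $r$-partition of $\mathcal{H}$. A subset of $V(\mathcal{H})$ is independent if it does not contain any hyperedge as a subset. A vertex cover is a subset of $V(\mathcal{H})$ that intersects every hyperedge; it is minimal if no proper subset of it is a vertex cover. $\mathcal{H}$ is unmixed if all its minimal vertex covers have the same cardinality. In a $d$-uniform hypergraph, a clique is a subset $W\subseteq V(\mathcal{H})$ such that every subset of $W$ of size $d$ is a hyperedge. A submaximal edge is a $(d-1)$-element subset of a hyperedge. For a submaximal edge $\mathfrak{e}$ and a vertex $v$, write $\mathfrak{e}\sim v$ if $\mathfrak{e}\cup\{v\}\in E(\mathcal{H})$. A $d$-uniform $r$-partite hypergraph with $2\le d\le r$ satisfies condition $(\ast\ast)$ for $r$ if it has an $r$-partition into parts $V_i=\{x_{1i},\ldots,x_{ni}\}$, $1\le i\le r$ (each with $n$ distinct vertices), such that $\{x_{j1},\ldots,x_{jr}\}$ is a clique for every $1\le j\le n$. *)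

theory Defs
  imports Main "HOL-Library.Disjoint_Sets"
begin

text \<open>A hypergraph is given by its vertex set \<open>V\<close> and its set of hyperedges \<open>E\<close>.\<close>

definition hypergraph :: "'a set \<Rightarrow> 'a set set \<Rightarrow> bool" where
  "hypergraph V E \<longleftrightarrow> finite V \<and> V \<noteq> {} \<and> (\<forall>e\<in>E. e \<noteq> {} \<and> e \<subseteq> V) \<and> \<Union>E = V"

definition uniform :: "nat \<Rightarrow> 'a set set \<Rightarrow> bool" where
  "uniform d E \<longleftrightarrow> (\<forall>e\<in>E. card e = d)"

definition r_partition :: "nat \<Rightarrow> 'a set \<Rightarrow> 'a set set \<Rightarrow> 'a set set \<Rightarrow> bool" where
  "r_partition r V E P \<longleftrightarrow> partition_on V P \<and> card P = r \<and>
     (\<forall>p\<in>P. \<forall>u\<in>p. \<forall>v\<in>p. u \<noteq> v \<longrightarrow> \<not> (\<exists>e\<in>E. u \<in> e \<and> v \<in> e))"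

definition r_partite :: "nat \<Rightarrow> 'a set \<Rightarrow> 'a set set \<Rightarrow> bool" where
  "r_partite r V E \<longleftrightarrow> (\<exists>P. r_partition r V E P)"

definition independent_set :: "'a set \<Rightarrow> 'a set set \<Rightarrow> 'a set \<Rightarrow> bool" where
  "independent_set V E S \<longleftrightarrow> S \<subseteq> V \<and> \<not> (\<exists>e\<in>E. e \<subseteq> S)"

definition vertex_cover :: "'a set \<Rightarrow> 'a set set \<Rightarrow> 'a set \<Rightarrow> bool" where
  "vertex_cover V E C \<longleftrightarrow> C \<subseteq> V \<and> (\<forall>e\<in>E. C \<inter> e \<noteq> {})"

definition minimal_vertex_cover :: "'a set \<Rightarrow> 'a set set \<Rightarrow> 'a set \<Rightarrow> bool" where
  "minimal_vertex_cover V E C \<longleftrightarrow>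
     vertex_cover V E C \<and> \<not> (\<exists>C'. C' \<subset> C \<and> vertex_cover V E C')"

definition unmixed :: "'a set \<Rightarrow> 'a set set \<Rightarrow> bool" where
  "unmixed V E \<longleftrightarrow>
     (\<forall>C C'. minimal_vertex_cover V E C \<longrightarrow> minimal_vertex_cover V E C' \<longrightarrow> card C = card C')"

definition clique :: "nat \<Rightarrow> 'a set \<Rightarrow> 'a set set \<Rightarrow> 'a set \<Rightarrow> bool" where
  "clique d V E W \<longleftrightarrow> W \<subseteq> V \<and> (\<forall>S. S \<subseteq> W \<longrightarrow> card S = d \<longrightarrow> S \<in> E)"

definition submaximal_edge :: "nat \<Rightarrow> 'a set set \<Rightarrow> 'a set \<Rightarrow> bool" where
  "submaximal_edge d E s \<longleftrightarrow> card s = d - 1 \<and> (\<exists>e\<in>E. s \<subseteq> e)"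

definition adjacent :: "'a set set \<Rightarrow> 'a set \<Rightarrow> 'a \<Rightarrow> bool" where
  "adjacent E s v \<longleftrightarrow> s \<union> {v} \<in> E"

text \<open>Condition \<open>(**)\<close> for \<open>r\<close>, relative to a given labelling of the vertices:
  \<open>x j i\<close> is the \<open>j\<close>-th vertex of the \<open>i\<close>-th part, where \<open>1 \<le> j \<le> n\<close> and \<open>1 \<le> i \<le> r\<close>.
  Since \<^const>\<open>r_partition\<close> asks for exactly \<open>r\<close> parts, the parts of distinct indices are distinct,
  hence disjoint.\<close>

definition star_star_labelling ::
  "nat \<Rightarrow> nat \<Rightarrow> nat \<Rightarrow> 'a set \<Rightarrow> 'a set set \<Rightarrow> (nat \<Rightarrow> nat \<Rightarrow> 'a) \<Rightarrow> bool" where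
  "star_star_labelling d r n V E x \<longleftrightarrow>
     r_partition r V E ((\<lambda>i. (\<lambda>j. x j i) ` {1..n}) ` {1..r}) \<and>
     (\<forall>i\<in>{1..r}. inj_on (\<lambda>j. x j i) {1..n}) \<and>
     (\<forall>j\<in>{1..n}. clique d V E ((\<lambda>i. x j i) ` {1..r}))"

end

(* Every row {x q 1, ..., x q r} is a clique of size r, so a vertex cover meets it in at least
   r - d + 1 vertices, and the union of r - d + 1 parts is a cover attaining this bound in every row.
   Hence H is unmixed iff no minimal cover meets a row in r - d + 2 vertices.  Given a minimal cover
   that does, removing those vertices from their private edges yields submaximal edges whose union
   avoids the cover and is therefore independent.  Conversely, a minimal cover inside the complement
   of an independent union must contain all the vertices x q (i k). *)
theory Submission
  imports Defs
begin

section \<open>Vertex covers, independence and cliques in an arbitrary hypergraph\<close>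

lemma minimal_vertex_cover_imp_cover: "minimal_vertex_cover V E C \<Longrightarrow> vertex_cover V E C"
  by (simp add: minimal_vertex_cover_def)

text \<open>By minimality \<open>C - {v}\<close> misses some edge, and \<open>C\<close> can meet
  that edge only in \<open>v\<close>. These private edges later supply the submaximal edges.\<close>

lemma minimal_vertex_cover_private_edge:
  assumes "minimal_vertex_cover V E C" and "v \<in> C"
  obtains e where "e \<in> E" and "C \<inter> e = {v}"
proof -
  have cov: "vertex_cover V E C" and "\<not> vertex_cover V E (C - {v})"
    using assms unfolding minimal_vertex_cover_def by auto
  then obtain e where "e \<in> E" "(C - {v}) \<inter> e = {}"
    unfolding vertex_cover_def by blast
  moreover have "C \<inter> e \<noteq> {}"
    using cov \<open>e \<in> E\<close> unfolding vertex_cover_def by blast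
  ultimately show thesis
    using that by blast
qed

text \<open>Finiteness of \<open>C\<close> yields an inclusion-minimal element among the covers
  contained in it. This turns the complement of an independent set into a minimal cover avoiding
  that set.\<close>

lemma vertex_cover_contains_minimal:
  assumes "finite C" and "vertex_cover V E C"
  obtains C' where "C' \<subseteq> C" and "minimal_vertex_cover V E C'"
proof -
  let ?S = "{B. B \<subseteq> C \<and> vertex_cover V E B}"
  have "finite ?S" and "?S \<noteq> {}"
    using assms by auto
  from finite_has_minimal[OF this] obtain B where B: "B \<in> ?S"
    and min: "\<forall>B'\<in>?S. B' \<subseteq> B \<longrightarrow> B = B'"
    by (elim bexE)
  then have "B \<subseteq> C" and "vertex_cover V E B"
    by simp_all
  moreover have "\<not> vertex_cover V E B'" if "B' \<subset> B" for B'
    using min that \<open>B \<subseteq> C\<close> by (metis (mono_tags, lifting) mem_Collect_eq order_trans psubsetE)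
  ultimately have "minimal_vertex_cover V E B"
    unfolding minimal_vertex_cover_def by blast
  with \<open>B \<subseteq> C\<close> show thesis
    using that by blast
qed

lemma vertex_cover_compl:
  assumes "\<forall>e\<in>E. e \<subseteq> V" and "independent_set V E S"
  shows "vertex_cover V E (V - S)"
  using assms unfolding independent_set_def vertex_cover_def by blast

lemma independent_set_if_disjoint_cover:
  assumes "vertex_cover V E C" and "S \<subseteq> V" and "C \<inter> S = {}"
  shows "independent_set V E S"
  using assms unfolding independent_set_def vertex_cover_def by blast

text \<open>Any \<open>d\<close> vertices of the clique form an edge, so the cover can miss at most
  \<open>d - 1\<close> of them.\<close>

lemma card_vertex_cover_Int_clique:
  assumes "clique d V E W" and "vertex_cover V E C" and "finite W" and "d \<le> card W"
  shows "card W - d + 1 \<le> card (C \<inter> W)"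
proof -
  have "card (W - C) < d"
  proof (rule ccontr)
    assume "\<not> card (W - C) < d"
    then obtain S where S: "S \<subseteq> W - C" "card S = d"
      by (meson obtain_subset_with_card_n not_less)
    then have "S \<in> E"
      using assms(1) unfolding clique_def by blast
    then show False
      using S assms(2) unfolding vertex_cover_def by blast
  qed
  moreover have "card W = card (W - C) + card (C \<inter> W)"
    using card_Int_Diff[OF assms(3), of C] by (simp add: Int_commute)
  ultimately show ?thesis
    using assms(4) by linarith
qed

section \<open>The labelling as a coordinate system on the vertices\<close>

lemma labelling_image:
  assumes "star_star_labelling d r n V E x"
  shows "(\<lambda>(j, i). x j i) ` ({1..n} \<times> {1..r}) = V"
proof -
  have "\<Union>((\<lambda>i. (\<lambda>j. x j i) ` {1..n}) ` {1..r}) = V"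
    using assms by (simp add: star_star_labelling_def r_partition_def partition_on_def)
  then show ?thesis
    by auto
qed

text \<open>The partition is given as an image, so equal parts could collapse; having exactly
  \<open>r\<close> parts forces \<open>p\<close> to be injective. A shared vertex then determines
  its part index by disjointness, and its row index by injectivity within the part.\<close>

lemma labelling_inj_on:
  assumes "star_star_labelling d r n V E x"
  shows "inj_on (\<lambda>(j, i). x j i) ({1..n} \<times> {1..r})"
proof (rule inj_onI, clarify)
  fix j i j' i'
  assume ji: "j \<in> {1..n}" "i \<in> {1..r}" "j' \<in> {1..n}" "i' \<in> {1..r}" and eq: "x j i = x j' i'"
  define p where "p i = (\<lambda>j. x j i) ` {1..n}" for i
  have part: "partition_on V (p ` {1..r})" and "card (p ` {1..r}) = r"
    using assms unfolding star_star_labelling_def r_partition_def p_def by auto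
  then have "inj_on p {1..r}"
    by (simp add: eq_card_imp_inj_on)
  moreover have "x j i \<in> p i" "x j i \<in> p i'"
    unfolding p_def using ji(1) by blast (use ji(3) eq in blast)
  then have "p i \<inter> p i' \<noteq> {}"
    by blast
  then have "p i = p i'"
    using disjointD[OF partition_onD2[OF part], of "p i" "p i'"] ji(2,4) by blast
  ultimately have "i = i'"
    using ji by (auto dest: inj_onD)
  moreover have "inj_on (\<lambda>j. x j i) {1..n}"
    using assms ji unfolding star_star_labelling_def by blast
  ultimately show "j = j' \<and> i = i'"
    using ji eq by (auto dest: inj_onD)
qed

lemma labelling_edge_index_unique:
  assumes "star_star_labelling d r n V E x" and "e \<in> E"
    and "x j i \<in> e" "x j' i \<in> e" "j \<in> {1..n}" "j' \<in> {1..n}" "i \<in> {1..r}"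
  shows "j = j'"
proof -
  have parts: "\<forall>p\<in>(\<lambda>i. (\<lambda>j. x j i) ` {1..n}) ` {1..r}. \<forall>u\<in>p. \<forall>v\<in>p.
      u \<noteq> v \<longrightarrow> \<not> (\<exists>e\<in>E. u \<in> e \<and> v \<in> e)"
    using assms(1) unfolding star_star_labelling_def r_partition_def by (elim conjE)
  have "x j i = x j' i"
    using bspec[OF parts imageI[OF assms(7)]] assms(2-6) by blast
  moreover have "inj_on (\<lambda>j. x j i) {1..n}"
    using assms(1,7) by (simp add: star_star_labelling_def)
  ultimately show ?thesis
    using assms(5,6) by (auto dest: inj_onD)
qed

section \<open>Counting covers row by row\<close>

lemma card_eq_sum_rows:
  assumes "star_star_labelling d r n V E x" and "C \<subseteq> V"
  shows "card C = (\<Sum>j\<in>{1..n}. card (C \<inter> x j ` {1..r}))"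
proof -
  have "C = (\<Union>j\<in>{1..n}. C \<inter> x j ` {1..r})"
    using labelling_image[OF assms(1)] assms(2) by fastforce
  moreover have "card (\<Union>j\<in>{1..n}. C \<inter> x j ` {1..r}) = (\<Sum>j\<in>{1..n}. card (C \<inter> x j ` {1..r}))"
  proof (intro card_UN_disjoint ballI impI)
    fix j j' assume "j \<in> {1..n}" "j' \<in> {1..n}" "j \<noteq> j'"
    then have "x j i \<noteq> x j' i'" if "i \<in> {1..r}" "i' \<in> {1..r}" for i i'
      using inj_onD[OF labelling_inj_on[OF assms(1)], of "(j, i)" "(j', i')"] that by auto
    then show "(C \<inter> x j ` {1..r}) \<inter> (C \<inter> x j' ` {1..r}) = {}"
      by blast
  qed simp_all
  ultimately show ?thesis
    by simp
qed

lemma labelling_inj_on_row: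
  assumes "star_star_labelling d r n V E x" and "j \<in> {1..n}"
  shows "inj_on (x j) {1..r}"
proof (rule inj_onI)
  fix i i' assume "i \<in> {1..r}" "i' \<in> {1..r}" "x j i = x j i'"
  then show "i = i'"
    using inj_onD[OF labelling_inj_on[OF assms(1)], of "(j, i)" "(j, i')"] assms(2) by simp
qed

lemma card_cover_Int_row:
  assumes "star_star_labelling d r n V E x" and "vertex_cover V E C" and "d \<le> r" and "j \<in> {1..n}"
  shows "r - d + 1 \<le> card (C \<inter> x j ` {1..r})"
proof -
  have "clique d V E (x j ` {1..r})"
    using assms(1,4) by (simp add: star_star_labelling_def)
  moreover have "card (x j ` {1..r}) = r"
    using labelling_inj_on_row[OF assms(1,4)] by (simp add: card_image)
  ultimately show ?thesis
    using card_vertex_cover_Int_clique[OF _ assms(2), of d "x j ` {1..r}"] assms(3) by simp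
qed

lemma card_vertex_cover_ge:
  assumes "star_star_labelling d r n V E x" and "vertex_cover V E C" and "d \<le> r"
  shows "n * (r - d + 1) \<le> card C"
proof -
  have "(\<Sum>j\<in>{1..n}. r - d + 1) \<le> (\<Sum>j\<in>{1..n}. card (C \<inter> x j ` {1..r}))"
    by (rule sum_mono) (rule card_cover_Int_row[OF assms])
  then show ?thesis
    using card_eq_sum_rows[OF assms(1)] assms(2) unfolding vertex_cover_def by simp
qed

text \<open>Every row contributes at least \<open>r - d + 1\<close>, so the total attains its lower
  bound exactly when no row exceeds this value.\<close>

lemma card_vertex_cover_eq_iff:
  assumes "star_star_labelling d r n V E x" and "vertex_cover V E C" and "d \<le> r"
  shows "card C = n * (r - d + 1) \<longleftrightarrow> (\<forall>j\<in>{1..n}. card (C \<inter> x j ` {1..r}) \<le> r - d + 1)"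
proof
  assume R: "\<forall>j\<in>{1..n}. card (C \<inter> x j ` {1..r}) \<le> r - d + 1"
  have "(\<Sum>j\<in>{1..n}. card (C \<inter> x j ` {1..r})) \<le> (\<Sum>j\<in>{1..n}. r - d + 1)"
    by (rule sum_mono) (rule bspec[OF R])
  then have "card C \<le> n * (r - d + 1)"
    using card_eq_sum_rows[OF assms(1)] assms(2) unfolding vertex_cover_def by simp
  with card_vertex_cover_ge[OF assms] show "card C = n * (r - d + 1)"
    by simp
next
  assume L: "card C = n * (r - d + 1)"
  show "\<forall>j\<in>{1..n}. card (C \<inter> x j ` {1..r}) \<le> r - d + 1"
  proof (rule ccontr)
    assume "\<not> ?thesis"
    then have "\<exists>j\<in>{1..n}. r - d + 1 < card (C \<inter> x j ` {1..r})"
      by (simp add: not_le)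
    then have "(\<Sum>j\<in>{1..n}. r - d + 1) < (\<Sum>j\<in>{1..n}. card (C \<inter> x j ` {1..r}))"
      by (intro sum_strict_mono_ex1 ballI card_cover_Int_row[OF assms]) simp_all
    then show False
      using L card_eq_sum_rows[OF assms(1)] assms(2) unfolding vertex_cover_def by simp
  qed
qed

text \<open>An edge avoiding the first \<open>r - d + 1\<close> parts would lie in the other
  \<open>d - 1\<close> parts. It has at most one vertex in each, hence fewer than \<open>d\<close>
  vertices.\<close>

lemma vertex_cover_parts:
  assumes "star_star_labelling d r n V E x" and "\<forall>e\<in>E. e \<subseteq> V" and "uniform d E"
    and "1 \<le> d" and "d \<le> r"
  shows "vertex_cover V E ((\<lambda>(j, i). x j i) ` ({1..n} \<times> {1..r - d + 1}))"
    (is "vertex_cover V E (?f ` ?L)")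
  unfolding vertex_cover_def
proof (intro conjI ballI notI)
  have "?L \<subseteq> {1..n} \<times> {1..r}"
    using assms(4,5) by (intro Sigma_mono) simp_all
  then show "?f ` ?L \<subseteq> V"
    unfolding labelling_image[OF assms(1), symmetric] by (rule image_mono)
next
  fix e assume e: "e \<in> E" and disj: "?f ` ?L \<inter> e = {}"
  \<comment> \<open>Index pairs replace vertices here, so that \<open>snd\<close> reads off the part
    of a vertex.\<close>
  define A where "A = {p \<in> {1..n} \<times> {r - d + 2..r}. ?f p \<in> e}"
  have [simp]: "finite A"
    unfolding A_def by (rule finite_subset[of _ "{1..n} \<times> {r - d + 2..r}"]) auto
  have "e \<subseteq> ?f ` A"
  proof
    fix v assume v: "v \<in> e"
    then have "v \<in> ?f ` ({1..n} \<times> {1..r})"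
      using labelling_image[OF assms(1)] assms(2) e by blast
    then obtain j i where ji: "v = x j i" "j \<in> {1..n}" "i \<in> {1..r}"
      by auto
    have "i \<notin> {1..r - d + 1}"
    proof
      assume "i \<in> {1..r - d + 1}"
      then have "?f (j, i) \<in> ?f ` ?L"
        using ji(2) by (intro imageI SigmaI)
      then show False
        using disj v ji(1) by auto
    qed
    then have "(j, i) \<in> A"
      using v ji by (auto simp: A_def)
    with ji(1) show "v \<in> ?f ` A"
      by (intro image_eqI[of _ _ "(j, i)"]) simp_all
  qed
  then have "card e \<le> card A"
    by (rule surj_card_le[OF \<open>finite A\<close>])
  also have "inj_on snd A"
  proof (rule inj_onI)
    fix p p' assume *: "p \<in> A" "p' \<in> A" "snd p = snd p'"
    then show "p = p'"
      using labelling_edge_index_unique[OF assms(1) e, of "fst p" "snd p" "fst p'"] assms(4,5)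
      by (auto simp: A_def)
  qed
  then have "card A = card (snd ` A)"
    by (simp add: card_image)
  also have "\<dots> \<le> card {r - d + 2..r}"
    by (rule card_mono) (auto simp: A_def)
  also have "\<dots> < d"
    using assms(4,5) by simp
  finally show False
    using assms(3) e unfolding uniform_def by simp
qed

text \<open>The cover \<open>C0\<close> made of the first \<open>r - d + 1\<close> parts attains the
  lower bound, so it is minimal and its size is the only possible common size of minimal
  covers.\<close>

lemma unmixed_iff_rows:
  assumes lab: "star_star_labelling d r n V E x" and sub: "\<forall>e\<in>E. e \<subseteq> V"
    and uni: "uniform d E" and d: "1 \<le> d" "d \<le> r"
  shows "unmixed V E \<longleftrightarrow>
    (\<forall>C. minimal_vertex_cover V E C \<longrightarrow> (\<forall>j\<in>{1..n}. card (C \<inter> x j ` {1..r}) \<le> r - d + 1))"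
proof -
  define C0 where "C0 = (\<lambda>(j, i). x j i) ` ({1..n} \<times> {1..r - d + 1})"
  have cov: "vertex_cover V E C0"
    unfolding C0_def using vertex_cover_parts[OF lab sub uni d] .
  have "inj_on (\<lambda>(j, i). x j i) ({1..n} \<times> {1..r - d + 1})"
    by (rule inj_on_subset[OF labelling_inj_on[OF lab]]) (use d in auto)
  then have card: "card C0 = n * (r - d + 1)"
    unfolding C0_def by (simp add: card_image)
  have "finite C0"
    unfolding C0_def by simp
  \<comment> \<open>A proper subset of \<open>C0\<close> is smaller than any cover can be.\<close>
  have "\<not> vertex_cover V E C'" if "C' \<subset> C0" for C'
    using psubset_card_mono[OF \<open>finite C0\<close> that] card card_vertex_cover_ge[OF lab _ d(2), of C']
    by linarith
  with cov have "minimal_vertex_cover V E C0"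
    unfolding minimal_vertex_cover_def by blast
  then have "unmixed V E \<longleftrightarrow> (\<forall>C. minimal_vertex_cover V E C \<longrightarrow> card C = n * (r - d + 1))"
    unfolding unmixed_def by (metis card)
  also have "\<dots> \<longleftrightarrow>
    (\<forall>C. minimal_vertex_cover V E C \<longrightarrow> (\<forall>j\<in>{1..n}. card (C \<inter> x j ` {1..r}) \<le> r - d + 1))"
    using card_vertex_cover_eq_iff[OF lab minimal_vertex_cover_imp_cover d(2)]
    by (intro all_cong1 imp_cong refl)
  finally show ?thesis .
qed

theorem theorem3p3:
  fixes d r n :: nat and V :: "'a set" and E :: "'a set set" and x :: "nat \<Rightarrow> nat \<Rightarrow> 'a"
  assumes "2 \<le> d" and "d \<le> r" and "1 \<le> n"
    and "hypergraph V E" and "uniform d E" and "r_partite r V E"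
    and "star_star_labelling d r n V E x"
  shows "unmixed V E \<longleftrightarrow>
    (\<forall>q\<in>{1..n}. \<forall>(s :: nat \<Rightarrow> 'a set) (i :: nat \<Rightarrow> nat).
       (\<forall>k\<in>{1..r - d + 2}. submaximal_edge d E (s k)) \<longrightarrow>
       (\<forall>k\<in>{1..r - d + 2}. i k \<in> {1..r}) \<longrightarrow>
       inj_on i {1..r - d + 2} \<longrightarrow>
       (\<forall>k\<in>{1..r - d + 2}. adjacent E (s k) (x q (i k))) \<longrightarrow>
       \<not> independent_set V E (\<Union>k\<in>{1..r - d + 2}. s k))"
proof -
  have sub: "\<forall>e\<in>E. e \<subseteq> V" and fin: "finite V"
    using assms(4) unfolding hypergraph_def by auto
  let ?K = "{1..r - d + 2}"
  have unm: "unmixed V E \<longleftrightarrow>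
    (\<forall>C. minimal_vertex_cover V E C \<longrightarrow> (\<forall>j\<in>{1..n}. card (C \<inter> x j ` {1..r}) \<le> r - d + 1))"
    using unmixed_iff_rows[OF assms(7) sub assms(5)] assms(1,2) by simp
  show ?thesis
  proof (intro iffI ballI allI impI notI)
    fix q s i
    assume "unmixed V E" and q: "q \<in> {1..n}" and i: "\<forall>k\<in>?K. i k \<in> {1..r}" "inj_on i ?K"
      and adj: "\<forall>k\<in>?K. adjacent E (s k) (x q (i k))"
      and ind: "independent_set V E (\<Union>k\<in>?K. s k)"
    \<comment> \<open>The complement of the independent union is a cover; a minimal cover is taken
      inside it.\<close>
    obtain C where C: "C \<subseteq> V - (\<Union>k\<in>?K. s k)" "minimal_vertex_cover V E C"
      using vertex_cover_contains_minimal[OF _ vertex_cover_compl[OF sub ind]] fin by blast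
    have "x q (i k) \<in> C" if "k \<in> ?K" for k
    proof -
      \<comment> \<open>This set is an edge by adjacency. Since \<open>C\<close> avoids
        \<open>s k\<close>, it can meet the edge only in \<open>x q (i k)\<close>.\<close>
      have "C \<inter> (s k \<union> {x q (i k)}) \<noteq> {}"
        using adj minimal_vertex_cover_imp_cover[OF C(2)] that
        unfolding adjacent_def vertex_cover_def by blast
      then show ?thesis
        using C(1) that by blast
    qed
    then have "x q ` i ` ?K \<subseteq> C \<inter> x q ` {1..r}"
      using i(1) by auto
    moreover have "inj_on (x q) (i ` ?K)"
      using labelling_inj_on_row[OF assms(7) q] by (rule inj_on_subset) (use i(1) in auto)
    then have "card (x q ` i ` ?K) = r - d + 2"
      using i(2) by (simp add: card_image)
    ultimately have "r - d + 2 \<le> card (C \<inter> x q ` {1..r})"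
      by (metis card_mono finite_Int finite_imageI finite_atLeastAtMost)
    moreover have "card (C \<inter> x q ` {1..r}) \<le> r - d + 1"
      using unm \<open>unmixed V E\<close> C(2) q by blast
    ultimately show False
      by simp
  next
    assume cond: "\<forall>q\<in>{1..n}. \<forall>s i. (\<forall>k\<in>?K. submaximal_edge d E (s k)) \<longrightarrow>
      (\<forall>k\<in>?K. i k \<in> {1..r}) \<longrightarrow> inj_on i ?K \<longrightarrow> (\<forall>k\<in>?K. adjacent E (s k) (x q (i k))) \<longrightarrow>
      \<not> independent_set V E (\<Union>k\<in>?K. s k)"
    show "unmixed V E"
      unfolding unm
    proof (intro allI impI ballI, rule ccontr)
      fix C q
      assume C: "minimal_vertex_cover V E C" and q: "q \<in> {1..n}"
        and "\<not> card (C \<inter> x q ` {1..r}) \<le> r - d + 1"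
      moreover define I where "I = {i \<in> {1..r}. x q i \<in> C}"
      moreover have "C \<inter> x q ` {1..r} = x q ` I"
        unfolding I_def by auto
      ultimately have "r - d + 2 \<le> card I"
        using card_image_le[of I "x q"] by simp
      \<comment> \<open>The row may contain more cover vertices than needed; exactly
        \<open>r - d + 2\<close> of their part indices are kept and enumerated by
        \<open>i\<close>.\<close>
      then obtain J where "J \<subseteq> I" and "card J = card ?K" "finite J"
        using obtain_subset_with_card_n[of "r - d + 2" I] by auto
      then obtain i where i: "bij_betw i ?K J"
        using finite_same_card_bij[of ?K J] by auto
      then have ir: "i k \<in> {1..r}" and iC: "x q (i k) \<in> C" if "k \<in> ?K" for k
        using \<open>J \<subseteq> I\<close> that unfolding I_def by (auto dest!: bij_betw_apply)
      have "\<forall>k\<in>?K. \<exists>e\<in>E. C \<inter> e = {x q (i k)}"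
        using minimal_vertex_cover_private_edge[OF C] iC by metis
      then obtain e where e: "\<And>k. k \<in> ?K \<Longrightarrow> e k \<in> E \<and> C \<inter> e k = {x q (i k)}"
        by metis
      \<comment> \<open>Deleting the only vertex of \<open>e k\<close> in \<open>C\<close> leaves
        \<open>d - 1\<close> vertices, all outside \<open>C\<close>.\<close>
      define s where "s k = e k - {x q (i k)}" for k
      have "submaximal_edge d E (s k)" if "k \<in> ?K" for k
      proof -
        have "x q (i k) \<in> e k" "card (e k) = d"
          using e[OF that] assms(5) unfolding uniform_def by auto
        then show ?thesis
          using e[OF that] unfolding submaximal_edge_def s_def by auto
      qed
      moreover have "adjacent E (s k) (x q (i k))" if "k \<in> ?K" for k
      proof -
        have "s k \<union> {x q (i k)} = e k"
          using e[OF that] unfolding s_def by auto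
        then show ?thesis
          using e[OF that] unfolding adjacent_def by simp
      qed
      \<comment> \<open>Each \<open>s k\<close> avoids \<open>C\<close>, so an edge inside the union
        would be missed by the cover \<open>C\<close>.\<close>
      moreover have "independent_set V E (\<Union>k\<in>?K. s k)"
      proof (rule independent_set_if_disjoint_cover)
        show "vertex_cover V E C"
          using C by (rule minimal_vertex_cover_imp_cover)
        show "(\<Union>k\<in>?K. s k) \<subseteq> V" "C \<inter> (\<Union>k\<in>?K. s k) = {}"
          using e sub unfolding s_def by blast+
      qed
      moreover have "inj_on i ?K"
        using i by (rule bij_betw_imp_inj_on)
      ultimately show False
        using cond q ir by blast
    qed
  qed
qed

end
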